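(* Let $f,\bar f:\mathbb V^{n_x}\to\mathbb V^{n_x}$ be the full-system and truth full-system uncertainty-propagation operators of a network with component operators $f_i,\bar f_i$, $i=1,\dots,n$; let $h$ be a fixed-point operator for $f$ and $\bar h$ a truth fixed-point operator for $\bar f$. Let $x_\star$ be a solution of $x_\star=f(x_\star)$ (so that $x_\star=h(x_\star)$) and $\bar x_\star$ a solution of $\bar x_\star=\bar f(\bar x_\star)$ (so that $\bar x_\star=\bar h(\bar x_\star)$). Assume: (i) For each $i$ there are linear subspaces $\mathbb X_i\subseteq\bar{\mathbb X}_i\subseteq\mathbb V^{n_{x,i}}$ with $\mathrm{Im}(f_i)\subseteq\mathbb X_i$ and $\mathrm{Im}(\bar f_i)\subseteq\bar{\mathbb X}_i$. Let $P$ be the orthogonal projector onto $\mathbb X=\mathbb X_1\times\cdots\times\mathbb X_n$. (ii) There is a constant $L_{P\bar h}<1$ such that $$\|P\bar h(x_1)-P\bar h(x_2)\|\le L_{P\bar h}\|Px_1-Px_2\|\qquad\text{for all }x_1,x_2\in\mathbb V^{n_x}.$$ Then the in-plane error satisfies $$\|P\bar x_\star-x_\star\|\le\frac{1}{1-L_{P\bar h}}\,\|x_\star-P\bar h(x_\star)\|.$$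
   Context: $\mathbb V$ is the real vector space of real-valued random variables on a fixed probability space, with norm induced by an inner product (e.g. $\|x\|=\sqrt{\mathbb E[x^2]}$); it may be treated as an abstract real inner product space. $\mathbb V^N$ carries the product inner product (sum of the componentwise inner products) and its norm. Network: there are $n$ components; component $i$ has $n_{y,i}$ endogenous inputs and $n_{x,i}$ outputs, $n_y=\sum_i n_{y,i}$, $n_x=\sum_i n_{x,i}$. Exogenous inputs are fixed throughout and suppressed from the notation. Each component has an uncertainty-propagation operator $f_i:\mathbb V^{n_{y,i}}\to\mathbb V^{n_{x,i}}$ and a "truth" operator $\bar f_i:\mathbb V^{n_{y,i}}\to\mathbb V^{n_{x,i}}$. $E_i^x\in\{0,1\}^{n_{x,i}\times n_x}$ and $E_i^y\in\{0,1\}^{n_{y,i}\times n_y}$ are the rows of the identity matrix extracting the block of component $i$. The adjacency matrix $A\in\{0,1\}^{n_y\times n_x}$ expresses the endogenous inputs as outputs, $y=Ax$; its diagonal blocks $E_i^yA(E_i^x)^T$ are zero. The full-system operators are $$f(x)=\sum_{i=1}^n(E_i^x)^Tf_i(E_i^yAx),\qquad \bar f(x)=\sum_{i=1}^n(E_i^x)^T\bar f_i(E_i^yAx).$$ A fixed-point operator for $f$ is any function $h:\mathbb V^{n_x}\to\mathbb V^{n_x}$ such that $x\mapsto x-h(x)$ and $x\mapsto x-f(x)$ have the same roots; a truth fixed-point operator is any function $\bar h:\mathbb V^{n_x}\to\mathbb V^{n_x}$ such that $x\mapsto x-\bar h(x)$ and $x\mapsto x-\bar f(x)$ have the same roots.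 The orthogonal projectors $P_i$ onto $\mathbb X_i$ are assumed to exist: $P_i$ is the linear operator with $P_iz=\arg\min_{\tilde z\in\mathbb X_i}\|z-\tilde z\|$, and $P=\sum_{i=1}^n(E_i^x)^TP_iE_i^x$. *)

theory Defs
  imports "HOL-Analysis.Inner_Product" "Jordan_Normal_Form.Matrix"
begin

text \<open>
  The space of random variables is an arbitrary type \<open>'v :: real_inner\<close>, and \<open>V\<^sup>N\<close> is
  \<^term>\<open>carrier_vec N :: 'v vec set\<close>. The inner product on \<open>V\<^sup>N\<close>, scaling by a real number and
  the action of real matrices are defined here, because the corresponding operations of
  the matrix library require the entries and the scalars to have the same type.
\<close>

definition vinner :: "'v::real_inner vec \<Rightarrow> 'v vec \<Rightarrow> real" where
  "vinner x y = (\<Sum>k<dim_vec x. inner (x $ k) (y $ k))"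

definition vnorm :: "'v::real_inner vec \<Rightarrow> real" where
  "vnorm x = sqrt (vinner x x)"

definition vscale :: "real \<Rightarrow> 'v::real_inner vec \<Rightarrow> 'v vec" where
  "vscale c x = map_vec (\<lambda>a. c *\<^sub>R a) x"

definition mat_app :: "real mat \<Rightarrow> 'v::real_inner vec \<Rightarrow> 'v vec" where
  "mat_app M x = vec (dim_row M) (\<lambda>r. \<Sum>s<dim_col M. M $$ (r, s) *\<^sub>R x $ s)"

definition vsubspace :: "nat \<Rightarrow> 'v::real_inner vec set \<Rightarrow> bool" where
  "vsubspace N S \<longleftrightarrow> S \<subseteq> carrier_vec N \<and> 0\<^sub>v N \<in> S \<and>
     (\<forall>x\<in>S. \<forall>y\<in>S. x + y \<in> S) \<and> (\<forall>c. \<forall>x\<in>S. vscale c x \<in> S)"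

definition vlinear :: "nat \<Rightarrow> nat \<Rightarrow> ('v::real_inner vec \<Rightarrow> 'v vec) \<Rightarrow> bool" where
  "vlinear N M T \<longleftrightarrow> T \<in> carrier_vec N \<rightarrow> carrier_vec M \<and>
     (\<forall>x\<in>carrier_vec N. \<forall>y\<in>carrier_vec N. T (x + y) = T x + T y) \<and>
     (\<forall>c. \<forall>x\<in>carrier_vec N. T (vscale c x) = vscale c (T x))"

definition orth_projector :: "nat \<Rightarrow> 'v::real_inner vec set \<Rightarrow> ('v vec \<Rightarrow> 'v vec) \<Rightarrow> bool" where
  "orth_projector N S T \<longleftrightarrow> vlinear N N T \<and>
     (\<forall>z\<in>carrier_vec N. is_arg_min (\<lambda>w. vnorm (z - w)) (\<lambda>w. w \<in> S) (T z))"

text \<open>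
  Components are numbered \<open>0, \<dots>, n - 1\<close>. For block sizes \<open>m\<close> (inputs \<open>ny\<close> or outputs \<open>nx\<close>),
  \<open>block_mat n m i\<close> consists of the \<open>m i\<close> rows of the identity matrix that belong to block \<open>i\<close>;
  it is \<open>E\<^sub>i\<^sup>y\<close> for \<open>m = ny\<close> and \<open>E\<^sub>i\<^sup>x\<close> for \<open>m = nx\<close>.
\<close>

definition total_dim :: "nat \<Rightarrow> (nat \<Rightarrow> nat) \<Rightarrow> nat" where
  "total_dim n m = (\<Sum>i<n. m i)"

definition block_mat :: "nat \<Rightarrow> (nat \<Rightarrow> nat) \<Rightarrow> nat \<Rightarrow> real mat" where
  "block_mat n m i =
     mat (m i) (total_dim n m) (\<lambda>(r, s). 1\<^sub>m (total_dim n m) $$ ((\<Sum>j<i. m j) + r, s))"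

definition adjacency_matrix ::
    "nat \<Rightarrow> (nat \<Rightarrow> nat) \<Rightarrow> (nat \<Rightarrow> nat) \<Rightarrow> real mat \<Rightarrow> bool" where
  "adjacency_matrix n ny nx A \<longleftrightarrow>
     A \<in> carrier_mat (total_dim n ny) (total_dim n nx) \<and> elements_mat A \<subseteq> {0, 1} \<and>
     (\<forall>i<n. block_mat n ny i * A * transpose_mat (block_mat n nx i) = 0\<^sub>m (ny i) (nx i))"

definition full_system ::
    "nat \<Rightarrow> (nat \<Rightarrow> nat) \<Rightarrow> (nat \<Rightarrow> nat) \<Rightarrow> real mat \<Rightarrow>
     (nat \<Rightarrow> 'v::real_inner vec \<Rightarrow> 'v vec) \<Rightarrow> 'v vec \<Rightarrow> 'v vec" where
  "full_system n ny nx A f x =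
     finsum_vec TYPE('v) (total_dim n nx)
       (\<lambda>i. mat_app (transpose_mat (block_mat n nx i))
              (f i (mat_app (block_mat n ny i) (mat_app A x)))) {..<n}"

definition block_projector ::
    "nat \<Rightarrow> (nat \<Rightarrow> nat) \<Rightarrow> (nat \<Rightarrow> 'v::real_inner vec \<Rightarrow> 'v vec) \<Rightarrow> 'v vec \<Rightarrow> 'v vec" where
  "block_projector n nx Q z =
     finsum_vec TYPE('v) (total_dim n nx)
       (\<lambda>i. mat_app (transpose_mat (block_mat n nx i))
              (Q i (mat_app (block_mat n nx i) z))) {..<n}"

definition fixed_point_operator ::
    "nat \<Rightarrow> ('v::real_inner vec \<Rightarrow> 'v vec) \<Rightarrow> ('v vec \<Rightarrow> 'v vec) \<Rightarrow> bool" where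
  "fixed_point_operator N F h \<longleftrightarrow> h \<in> carrier_vec N \<rightarrow> carrier_vec N \<and>
     {x \<in> carrier_vec N. x - h x = 0\<^sub>v N} = {x \<in> carrier_vec N. x - F x = 0\<^sub>v N}"

end

theory Submission
  imports Defs "HOL-Analysis.L2_Norm"
begin

text \<open>
  Put \<open>u = P xbar_star\<close>. The fixed point \<open>x_star\<close> is assembled from the blocks
  \<open>f i (\<dots>) \<in> X i\<close>, and an orthogonal projector fixes every point of its subspace, so
  \<open>P x_star = x_star\<close>. The truth fixed point satisfies \<open>hbar xbar_star = xbar_star\<close>, so
  \<open>u = P (hbar xbar_star)\<close>. The Lipschitz condition at the pair \<open>xbar_star, x_star\<close> then
  bounds the norm of \<open>u - P (hbar x_star)\<close> by \<open>L\<close> times the norm of \<open>P xbar_star - P x_star\<close>, which is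
  the norm of the error \<open>u - x_star\<close> itself. By the triangle inequality

  \<open>vnorm (u - x_star) \<le> L * vnorm (u - x_star) + vnorm (x_star - P (hbar x_star))\<close>,

  and the claim follows by dividing by \<open>1 - L > 0\<close>.

  The error reappears on the right-hand side only because \<open>P\<close> fixes \<open>x_star\<close>. That in
  turn rests on the block structure: \<open>E\<^sub>i E\<^sub>j\<^sup>T\<close> is the identity for \<open>i = j\<close> and zero
  otherwise, so extracting block \<open>i\<close> of an assembled vector returns what was put there
  (\<open>extract_block_assembled\<close>).
\<close>

text \<open>The triangle inequality is inherited from the Euclidean norm of the real vector
  that has the componentwise norms as its entries.\<close>

lemma vnorm_eq_L2_set: "vnorm x = L2_set (\<lambda>k. norm (x $ k)) {..<dim_vec x}"
  by (simp add: vnorm_def vinner_def L2_set_def power2_norm_eq_inner)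

lemma vnorm_triangle:
  assumes "x \<in> carrier_vec N" "y \<in> carrier_vec N" "z \<in> carrier_vec N"
  shows "vnorm (x - z) \<le> vnorm (x - y) + vnorm (y - z)"
proof -
  have "vnorm (x - z) = L2_set (\<lambda>k. norm (x $ k - z $ k)) {..<N}"
    using assms by (auto simp: vnorm_eq_L2_set intro!: L2_set_cong)
  also have "\<dots> \<le> L2_set (\<lambda>k. norm (x $ k - y $ k) + norm (y $ k - z $ k)) {..<N}"
    by (intro L2_set_mono) (auto intro: norm_diff_triangle_le)
  also have "\<dots> \<le> L2_set (\<lambda>k. norm (x $ k - y $ k)) {..<N}
                  + L2_set (\<lambda>k. norm (y $ k - z $ k)) {..<N}"
    by (rule L2_set_triangle_ineq)
  also have "\<dots> = vnorm (x - y) + vnorm (y - z)"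
    using assms by (auto simp: vnorm_eq_L2_set intro!: arg_cong2[of _ _ _ _ "(+)"] L2_set_cong)
  finally show ?thesis .
qed

lemma vnorm_minus_commute:
  assumes "x \<in> carrier_vec N" "y \<in> carrier_vec N"
  shows "vnorm (x - y) = vnorm (y - x)"
  using assms by (auto simp: vnorm_eq_L2_set norm_minus_commute intro!: L2_set_cong)

lemma vnorm_diff_eq_0_iff:
  assumes "x \<in> carrier_vec N" "y \<in> carrier_vec N"
  shows "vnorm (x - y) = 0 \<longleftrightarrow> x = y"
  using assms by (auto simp: vnorm_eq_L2_set L2_set_eq_0_iff)

lemma vnorm_nonneg: "0 \<le> vnorm x"
  by (simp add: vnorm_eq_L2_set)

text \<open>A point of the subspace is at distance zero from itself, so its best approximation
  must also be at distance zero.\<close>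

lemma orth_projector_fixes:
  assumes T: "orth_projector N S T" and z: "z \<in> S" "z \<in> carrier_vec N"
  shows "T z = z"
proof -
  have Tz: "T z \<in> carrier_vec N"
    and min: "is_arg_min (\<lambda>w. vnorm (z - w)) (\<lambda>w. w \<in> S) (T z)"
    using T z by (auto simp: orth_projector_def vlinear_def)
  have "vnorm (z - T z) \<le> vnorm (z - z)"
    using min z(1) unfolding is_arg_min_linorder by blast
  also have "\<dots> = 0"
    using vnorm_diff_eq_0_iff[OF z(2) z(2)] by (rule iffD2) simp
  finally have "vnorm (z - T z) = 0"
    using vnorm_nonneg[of "z - T z"] by linarith
  with z Tz show ?thesis
    by (simp add: vnorm_diff_eq_0_iff)
qed

text \<open>Both \<^const>\<open>full_system\<close> and \<^const>\<open>block_projector\<close> have this form. Treating them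
  alike turns the claim that the projector fixes the fixed point of a system into a
  comparison of two families of blocks.\<close>

definition assemble :: "nat \<Rightarrow> (nat \<Rightarrow> nat) \<Rightarrow> (nat \<Rightarrow> 'v::real_inner vec) \<Rightarrow> 'v vec" where
  "assemble n m g = finsum_vec TYPE('v) (total_dim n m)
     (\<lambda>i. mat_app (transpose_mat (block_mat n m i)) (g i)) {..<n}"

lemma full_system_eq_assemble:
  "full_system n ny nx A f x =
     assemble n nx (\<lambda>i. f i (mat_app (block_mat n ny i) (mat_app A x)))"
  by (simp add: full_system_def assemble_def)

lemma block_projector_eq_assemble:
  "block_projector n nx Q z = assemble n nx (\<lambda>i. Q i (mat_app (block_mat n nx i) z))"
  by (simp add: block_projector_def assemble_def)

lemma mat_app_carrier: "M \<in> carrier_mat r c \<Longrightarrow> mat_app M x \<in> carrier_vec r"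
  by (simp add: mat_app_def)

lemma block_mat_carrier: "block_mat n m i \<in> carrier_mat (m i) (total_dim n m)"
  by (simp add: block_mat_def)

lemma embed_block_carrier:
  "mat_app (transpose_mat (block_mat n m i)) v \<in> carrier_vec (total_dim n m)"
  using block_mat_carrier by (intro mat_app_carrier) simp

lemma assemble_carrier: "assemble n m g \<in> carrier_vec (total_dim n m)"
  unfolding assemble_def by (intro finsum_vec_closed) (auto intro: embed_block_carrier)

lemma assemble_cong:
  assumes "\<And>i. i < n \<Longrightarrow> g i = g' i"
  shows "assemble n m g = assemble n m g'"
  unfolding assemble_def finsum_vec_def
  using assms embed_block_carrier
  by (intro comm_monoid.finprod_cong'[OF comm_monoid_vec]) (auto simp: monoid_vec_simps)

lemma block_index_less:
  fixes m :: "nat \<Rightarrow> nat"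
  assumes "i < n" "r < m i"
  shows "(\<Sum>j<i. m j) + r < total_dim n m"
proof -
  have "(\<Sum>j<i. m j) + r < (\<Sum>j<Suc i. m j)"
    using assms by simp
  also have "\<dots> \<le> total_dim n m"
    unfolding total_dim_def using assms by (intro sum_mono2) auto
  finally show ?thesis .
qed

text \<open>The global index range of a block ends where the next one starts, so a global
  index determines both the block and the position inside it.\<close>

lemma block_index_inj:
  fixes m :: "nat \<Rightarrow> nat"
  assumes "r < m i" "s < m j" and eq: "(\<Sum>l<i. m l) + r = (\<Sum>l<j. m l) + s"
  shows "i = j \<and> r = s"
proof -
  have sep: "(\<Sum>l<a. m l) + t < (\<Sum>l<b. m l) + u" if "a < b" "t < m a" for a b t u
    using block_index_less[where m = m, OF that] that by (simp add: total_dim_def)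
  show ?thesis
    using sep[of i j r s] sep[of j i s r] assms by (cases i j rule: linorder_cases) auto
qed

lemma extract_block_index:
  assumes "i < n" "r < m i"
  shows "mat_app (block_mat n m i) x $ r = x $ ((\<Sum>j<i. m j) + r)"
proof -
  have "mat_app (block_mat n m i) x $ r =
      (\<Sum>s<total_dim n m. (if (\<Sum>j<i. m j) + r = s then 1 else 0) *\<^sub>R x $ s)"
    using assms block_index_less[where m = m, OF assms] by (simp add: mat_app_def block_mat_def)
  also have "\<dots> = (\<Sum>s<total_dim n m. if (\<Sum>j<i. m j) + r = s then x $ s else 0)"
    by (rule sum.cong) simp_all
  also have "\<dots> = x $ ((\<Sum>j<i. m j) + r)"
    using block_index_less[where m = m, OF assms] by simp
  finally show ?thesis .
qed

lemma embed_block_index: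
  assumes "i < n" "r < m i" "j < n"
  shows "mat_app (transpose_mat (block_mat n m j)) v $ ((\<Sum>l<i. m l) + r) =
    (if j = i then v $ r else 0)"
proof -
  have "mat_app (transpose_mat (block_mat n m j)) v $ ((\<Sum>l<i. m l) + r) =
      (\<Sum>s<m j. if j = i \<and> s = r then v $ s else 0)"
    using assms block_index_less[of i n r m] block_index_less[of j n _ m]
      block_index_inj[of _ m j r i]
    by (auto simp: mat_app_def block_mat_def intro!: sum.cong)
  then show ?thesis
    using assms by (cases "j = i") simp_all
qed

text \<open>This is the block relation \<open>E\<^sub>i E\<^sub>j\<^sup>T = I\<close> or \<open>0\<close>, summed over \<open>j\<close>: only the
  \<open>i\<close>-th summand of the assembled vector reaches the index range of block \<open>i\<close>.\<close>

lemma extract_block_assembled: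
  assumes "i < n" "g i \<in> carrier_vec (m i)"
  shows "mat_app (block_mat n m i) (assemble n m g) = g i"
proof (rule eq_vecI)
  fix r assume "r < dim_vec (g i)"
  then have r: "r < m i" using assms by simp
  have "mat_app (block_mat n m i) (assemble n m g) $ r
      = assemble n m g $ ((\<Sum>j<i. m j) + r)"
    using assms r by (simp add: extract_block_index)
  also have "\<dots> = (\<Sum>j<n. mat_app (transpose_mat (block_mat n m j)) (g j) $ ((\<Sum>l<i. m l) + r))"
    unfolding assemble_def using block_index_less[where m = m, OF assms(1) r]
    by (intro index_finsum_vec) (auto intro: embed_block_carrier)
  also have "\<dots> = (\<Sum>j<n. if j = i then g j $ r else 0)"
    using assms r by (intro sum.cong) (auto simp: embed_block_index)
  also have "\<dots> = g i $ r"
    using assms by simp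
  finally show "mat_app (block_mat n m i) (assemble n m g) $ r = g i $ r" .
qed (use assms in \<open>simp add: mat_app_def block_mat_def\<close>)

text \<open>The blockwise projector takes an assembled vector apart, projects each block and
  reassembles; blocks that already lie in their subspaces come back unchanged.\<close>

lemma block_projector_fixes_assembled:
  assumes "\<And>i. i < n \<Longrightarrow> orth_projector (m i) (X i) (Q i)"
    and "\<And>i. i < n \<Longrightarrow> g i \<in> X i" and "\<And>i. i < n \<Longrightarrow> g i \<in> carrier_vec (m i)"
  shows "block_projector n m Q (assemble n m g) = assemble n m g"
  unfolding block_projector_eq_assemble
  using assms
  by (intro assemble_cong) (metis extract_block_assembled orth_projector_fixes)

lemma fixed_point_operator_fixed_point:
  assumes h: "fixed_point_operator N F h" and x: "x \<in> carrier_vec N" "x = F x"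
  shows "h x = x"
proof -
  have "x - F x = 0\<^sub>v N"
    using x by (metis minus_cancel_vec)
  then have "x \<in> {x \<in> carrier_vec N. x - F x = 0\<^sub>v N}"
    using x by blast
  then have "x - h x = 0\<^sub>v N" and hx: "h x \<in> carrier_vec N"
    using h x by (auto simp: fixed_point_operator_def)
  have "(x - h x) $ k = 0" if "k < N" for k
    using \<open>x - h x = 0\<^sub>v N\<close> that by simp
  then show ?thesis
    using x hx by (intro eq_vecI) auto
qed

theorem proposition5p10:
  fixes n :: nat and ny nx :: "nat \<Rightarrow> nat" and A :: "real mat"
    and f fbar :: "nat \<Rightarrow> 'v::real_inner vec \<Rightarrow> 'v vec"
    and h hbar :: "'v vec \<Rightarrow> 'v vec"
    and x_star xbar_star :: "'v vec"
    and X Xbar :: "nat \<Rightarrow> 'v vec set"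
    and Q :: "nat \<Rightarrow> 'v vec \<Rightarrow> 'v vec" and P :: "'v vec \<Rightarrow> 'v vec"
    and L :: real
  assumes "adjacency_matrix n ny nx A"
    and "\<And>i. i < n \<Longrightarrow> f i \<in> carrier_vec (ny i) \<rightarrow> carrier_vec (nx i)"
    and "\<And>i. i < n \<Longrightarrow> fbar i \<in> carrier_vec (ny i) \<rightarrow> carrier_vec (nx i)"
    and "fixed_point_operator (total_dim n nx) (full_system n ny nx A f) h"
    and "fixed_point_operator (total_dim n nx) (full_system n ny nx A fbar) hbar"
    and "x_star \<in> carrier_vec (total_dim n nx)"
    and "x_star = full_system n ny nx A f x_star"
    and "xbar_star \<in> carrier_vec (total_dim n nx)"
    and "xbar_star = full_system n ny nx A fbar xbar_star"
    and "\<And>i. i < n \<Longrightarrow> vsubspace (nx i) (X i)"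
    and "\<And>i. i < n \<Longrightarrow> vsubspace (nx i) (Xbar i)"
    and "\<And>i. i < n \<Longrightarrow> X i \<subseteq> Xbar i"
    and "\<And>i. i < n \<Longrightarrow> f i ` carrier_vec (ny i) \<subseteq> X i"
    and "\<And>i. i < n \<Longrightarrow> fbar i ` carrier_vec (ny i) \<subseteq> Xbar i"
    and "\<And>i. i < n \<Longrightarrow> orth_projector (nx i) (X i) (Q i)"
    and "P = block_projector n nx Q"
    and "L < 1"
    and "\<And>x1 x2. x1 \<in> carrier_vec (total_dim n nx) \<Longrightarrow> x2 \<in> carrier_vec (total_dim n nx) \<Longrightarrow>
           vnorm (P (hbar x1) - P (hbar x2)) \<le> L * vnorm (P x1 - P x2)"
  shows "vnorm (P xbar_star - x_star) \<le> 1 / (1 - L) * vnorm (x_star - P (hbar x_star))"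
proof -
  let ?N = "total_dim n nx"
  note f_carrier = assms(2) and x_carrier = assms(6) and x_fixed = assms(7)
    and xbar_carrier = assms(8) and f_image = assms(13) and proj = assms(15)
    and P_eq = assms(16) and L_less = assms(17) and Lip = assms(18)
  let ?in = "\<lambda>i. mat_app (block_mat n ny i) (mat_app A x_star)"
  have in_carrier: "?in i \<in> carrier_vec (ny i)" for i
    by (rule mat_app_carrier[OF block_mat_carrier])
  have "P (assemble n nx (\<lambda>i. f i (?in i))) = assemble n nx (\<lambda>i. f i (?in i))"
    unfolding P_eq using in_carrier f_carrier f_image proj
    by (intro block_projector_fixes_assembled[where X = X]) blast+
  then have Px: "P x_star = x_star"
    using x_fixed by (simp add: full_system_eq_assemble)
  have hbar_xbar: "hbar xbar_star = xbar_star"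
    using assms(5) xbar_carrier assms(9) by (rule fixed_point_operator_fixed_point)
  have P_carrier: "P z \<in> carrier_vec ?N" for z
    by (simp add: P_eq block_projector_eq_assemble assemble_carrier)
  have "vnorm (P xbar_star - x_star)
      \<le> vnorm (P xbar_star - P (hbar x_star)) + vnorm (P (hbar x_star) - x_star)"
    by (rule vnorm_triangle[OF P_carrier P_carrier x_carrier])
  also have "vnorm (P xbar_star - P (hbar x_star)) \<le> L * vnorm (P xbar_star - x_star)"
    using Lip[OF xbar_carrier x_carrier] by (simp add: hbar_xbar Px)
  also have "vnorm (P (hbar x_star) - x_star) = vnorm (x_star - P (hbar x_star))"
    by (rule vnorm_minus_commute[OF P_carrier x_carrier])
  finally have "(1 - L) * vnorm (P xbar_star - x_star) \<le> vnorm (x_star - P (hbar x_star))"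
    by (simp add: algebra_simps)
  then show ?thesis
    using L_less by (simp add: field_simps)
qed

end
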